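(* If $\Re(\beta_1)>\Re(\alpha_2)>0$, $\Re(\beta_1-\alpha_2-\alpha_1)>0$ and $\min\{\Re(b),\Re(d)\}\ge0$, then $$ {}_{2}F_{1}^{(\kappa_l)}\left[\begin{array}{c}(\alpha_1,1),(\alpha_2,2)\\ \beta_1\end{array};1;b,d\right]=\frac{\Gamma(\beta_1)\Gamma(\beta_1-\alpha_2-\alpha_1)}{\Gamma(\beta_1-\alpha_2)\Gamma(\beta_1-\alpha_1)}\;{}_{2}F_{1}^{(\kappa_l)}\left[\begin{array}{c}\alpha_1,\alpha_2\\ \beta_1-\alpha_1\end{array};-1;b,d\right]. $$
   Context: Here $(a)_m=\Gamma(a+m)/\Gamma(a)$ is the Pochhammer symbol and $B(\cdot,\cdot)$ is Euler's beta function. Let $\{\kappa_l\}_{l\ge0}$ be a complex sequence with $\kappa_0=1$ and let $\Theta(z)=\Theta(\kappa_l;z)$ be a function analytic in a disk $|z|<R$ ($0<R<\infty$) with $\Theta(z)=\sum_{l\ge0}\kappa_l z^l/l!$ there, continued analytically to the half-plane $\Re(z)>0$ with $\Theta(z)=M_0z^{\omega}e^{z}[1+O(1/z)]$ as $\Re(z)\to\infty$ ($M_0>0$, $\omega\in\mathbb{C}$). It is also understood that $\Theta$ is defined and continuous on $\Re(z)\le 0$ and that the following integrals converge absolutely. For $\Re(b),\Re(d)\ge0$ and $\Re(\alpha),\Re(\beta)>0$, $$\mathcal{B}^{(\kappa_l)}_{b,d}(\alpha,\beta)=\int_0^1t^{\alpha-1}(1-t)^{\beta-1}\Theta\left(-\frac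 bt-\frac d{1-t}\right)dt .$$ For a non-negative integer $k_2$ and $\Re(\beta_1)>\Re(\alpha_2)>0$, define for $|z|<1$ $${}_{2}F_{1}^{(\kappa_l)}\left[\begin{array}{c}(\alpha_1,1),(\alpha_2,k_2)\\ \beta_1\end{array};z;b,d\right]=\sum_{n=0}^\infty(\alpha_1)_n\frac{\mathcal{B}^{(\kappa_l)}_{b,d}(\alpha_2+k_2n,\beta_1-\alpha_2)}{B(\alpha_2,\beta_1-\alpha_2)}\frac{z^n}{n!},$$ and for other $z$ (in particular $z=\pm1$) by the integral representation, when it converges, $$\frac{1}{B(\alpha_2,\beta_1-\alpha_2)}\int_0^1t^{\alpha_2-1}(1-t)^{\beta_1-\alpha_2-1}(1-zt^{k_2})^{-\alpha_1}\Theta\left(-\frac bt-\frac d{1-t}\right)dt .$$ The function ${}_{2}F_{1}^{(\kappa_l)}\left[\begin{array}{c}\alpha_1,\alpha_2\\ \beta_1\end{array};z;b,d\right]$ is the case $k_2=1$. *)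

theory Defs
  imports "HOL-Complex_Analysis.Complex_Analysis" "HOL-Library.Landau_Symbols"
begin

text \<open>
  On \<open>Re z \<le> 0\<close> outside the disk, \<open>\<Theta>\<close> is only required to be continuous, so it is not determined
  by the sequence \<open>\<kappa>\<close>; hence the functions below take \<open>\<Theta>\<close> itself as their parameter.
  The filter \<open>filtercomap Re at_top\<close> expresses \<open>Re z \<rightarrow> \<infinity>\<close>, uniformly in \<open>Im z\<close>.
\<close>

definition theta_kernel ::
  "(nat \<Rightarrow> complex) \<Rightarrow> real \<Rightarrow> real \<Rightarrow> complex \<Rightarrow> (complex \<Rightarrow> complex) \<Rightarrow> bool" where
  "theta_kernel \<kappa> R M\<^sub>0 \<omega> \<Theta> \<longleftrightarrow>
     \<kappa> 0 = 1 \<and> 0 < R \<and> 0 < M\<^sub>0 \<and>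
     \<Theta> analytic_on (ball 0 R \<union> {z. 0 < Re z}) \<and>
     (\<forall>z\<in>ball 0 R. (\<lambda>l. \<kappa> l * z ^ l / fact l) sums \<Theta> z) \<and>
     (\<exists>\<epsilon>\<in>O[filtercomap Re at_top](\<lambda>z. 1 / z).
        \<forall>\<^sub>F z in filtercomap Re at_top.
          \<Theta> z = of_real M\<^sub>0 * z powr \<omega> * exp z * (1 + \<epsilon> z)) \<and>
     continuous_on {z. Re z \<le> 0} \<Theta>"

definition ext_beta_integrand ::
  "(complex \<Rightarrow> complex) \<Rightarrow> complex \<Rightarrow> complex \<Rightarrow> complex \<Rightarrow> complex \<Rightarrow> real \<Rightarrow> complex" where
  "ext_beta_integrand \<Theta> b d \<alpha> \<beta> t =
     of_real t powr (\<alpha> - 1) * of_real (1 - t) powr (\<beta> - 1) *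
     \<Theta> (- b / of_real t - d / of_real (1 - t))"

definition ext_beta_converges ::
  "(complex \<Rightarrow> complex) \<Rightarrow> complex \<Rightarrow> complex \<Rightarrow> complex \<Rightarrow> complex \<Rightarrow> bool" where
  "ext_beta_converges \<Theta> b d \<alpha> \<beta> \<longleftrightarrow>
     set_integrable lborel {0<..<1} (ext_beta_integrand \<Theta> b d \<alpha> \<beta>)"

definition ext_beta ::
  "(complex \<Rightarrow> complex) \<Rightarrow> complex \<Rightarrow> complex \<Rightarrow> complex \<Rightarrow> complex \<Rightarrow> complex" where
  "ext_beta \<Theta> b d \<alpha> \<beta> = (LINT t:{0<..<1}|lborel. ext_beta_integrand \<Theta> b d \<alpha> \<beta> t)"

definition ext_2F1_integrand ::
  "(complex \<Rightarrow> complex) \<Rightarrow> complex \<Rightarrow> complex \<Rightarrow> nat \<Rightarrow> complex \<Rightarrow> complex \<Rightarrow> complex \<Rightarrow> complex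
     \<Rightarrow> real \<Rightarrow> complex" where
  "ext_2F1_integrand \<Theta> \<alpha>\<^sub>1 \<alpha>\<^sub>2 k\<^sub>2 \<beta>\<^sub>1 z b d t =
     of_real t powr (\<alpha>\<^sub>2 - 1) * of_real (1 - t) powr (\<beta>\<^sub>1 - \<alpha>\<^sub>2 - 1) *
     (1 - z * of_real t ^ k\<^sub>2) powr (- \<alpha>\<^sub>1) *
     \<Theta> (- b / of_real t - d / of_real (1 - t))"

definition ext_2F1_integral_converges ::
  "(complex \<Rightarrow> complex) \<Rightarrow> complex \<Rightarrow> complex \<Rightarrow> nat \<Rightarrow> complex \<Rightarrow> complex \<Rightarrow> complex \<Rightarrow> complex
     \<Rightarrow> bool" where
  "ext_2F1_integral_converges \<Theta> \<alpha>\<^sub>1 \<alpha>\<^sub>2 k\<^sub>2 \<beta>\<^sub>1 z b d \<longleftrightarrow>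
     set_integrable lborel {0<..<1} (ext_2F1_integrand \<Theta> \<alpha>\<^sub>1 \<alpha>\<^sub>2 k\<^sub>2 \<beta>\<^sub>1 z b d)"

text \<open>
  The value is meaningful for \<open>Re \<beta>\<^sub>1 > Re \<alpha>\<^sub>2 > 0\<close> and, if \<open>norm z \<ge> 1\<close>, only under
  \<open>ext_2F1_integral_converges\<close>; a divergent integral has the junk value \<open>0\<close>.
\<close>

definition ext_2F1 ::
  "(complex \<Rightarrow> complex) \<Rightarrow> complex \<Rightarrow> complex \<Rightarrow> nat \<Rightarrow> complex \<Rightarrow> complex \<Rightarrow> complex \<Rightarrow> complex
     \<Rightarrow> complex" where
  "ext_2F1 \<Theta> \<alpha>\<^sub>1 \<alpha>\<^sub>2 k\<^sub>2 \<beta>\<^sub>1 z b d =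
     (if norm z < 1 then
        (\<Sum>n. pochhammer \<alpha>\<^sub>1 n *
           (ext_beta \<Theta> b d (\<alpha>\<^sub>2 + of_nat (k\<^sub>2 * n)) (\<beta>\<^sub>1 - \<alpha>\<^sub>2) / Beta \<alpha>\<^sub>2 (\<beta>\<^sub>1 - \<alpha>\<^sub>2)) *
           (z ^ n / fact n))
      else
        1 / Beta \<alpha>\<^sub>2 (\<beta>\<^sub>1 - \<alpha>\<^sub>2) *
        (LINT t:{0<..<1}|lborel. ext_2F1_integrand \<Theta> \<alpha>\<^sub>1 \<alpha>\<^sub>2 k\<^sub>2 \<beta>\<^sub>1 z b d t))"

end

theory Submission
  imports Defs
begin

text \<open>
  On \<open>(0, 1)\<close> one has \<open>(1 - t\<^sup>2) powr (-\<alpha>\<^sub>1) = (1 - t) powr (-\<alpha>\<^sub>1) * (1 + t) powr (-\<alpha>\<^sub>1)\<close>, so both sides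
  have the same integrand and only the beta prefactors differ. That integrand is the one of the
  extended beta function at \<open>(\<alpha>\<^sub>2, \<beta>\<^sub>1 - \<alpha>\<^sub>1 - \<alpha>\<^sub>2)\<close> times a continuous function on \<open>[0, 1]\<close>,
  hence integrable.
\<close>

text \<open>Compactness of \<open>K\<close> bounds \<open>g\<close>, so the product is dominated on
  \<open>A\<close> by a constant multiple of \<open>f\<close>. Keeping \<open>A\<close> and
  \<open>K\<close> apart allows \<open>f\<close> to be singular at the endpoints of an open interval
  while \<open>g\<close> extends continuously to the closed one.\<close>

lemma set_integrable_mult_continuous_bounded:
  fixes f g :: "real \<Rightarrow> complex"
  assumes f: "set_integrable lborel A f" and g: "continuous_on K g"
    and A: "A \<in> sets borel" "A \<subseteq> K" and K: "compact K"
  shows "set_integrable lborel A (\<lambda>t. f t * g t)"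
proof -
  obtain B where B: "\<And>t. t \<in> K \<Longrightarrow> norm (g t) \<le> B"
    using compact_continuous_image[OF g K] compact_imp_bounded bounded_iff
    by (metis imageI)
  have Cf: "set_integrable lborel A (\<lambda>t. of_real B * f t)"
    using f by (intro set_integrable_mult_right) auto
  have "set_borel_measurable borel A g"
    using borel_measurable_continuous_on_indicator[OF A(1) continuous_on_subset[OF g A(2)]]
    by (simp add: set_borel_measurable_def)
  \<comment> \<open>Measurability is known only for the truncations of \<open>f\<close> and
    \<open>g\<close> to \<open>A\<close>; their product is the truncated product because the
    indicator is idempotent.\<close>
  then have "(\<lambda>t. (indicator A t *\<^sub>R f t) * (indicator A t *\<^sub>R g t)) \<in> borel_measurable lborel"
    using f unfolding set_integrable_def set_borel_measurable_def
    by (intro borel_measurable_times) (auto dest: borel_measurable_integrable)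
  also have "(\<lambda>t. (indicator A t *\<^sub>R f t) * (indicator A t *\<^sub>R g t)) =
      (\<lambda>t. indicator A t *\<^sub>R (f t * g t))"
    by (auto simp: indicator_def)
  finally have "set_borel_measurable lborel A (\<lambda>t. f t * g t)"
    by (simp add: set_borel_measurable_def)
  moreover have "norm (f t * g t) \<le> norm (of_real B * f t)" if "t \<in> A" for t
  proof -
    \<comment> \<open>The absolute value appears because \<open>norm (of_real B)\<close> is
      \<open>\<bar>B\<bar>\<close>.\<close>
    have "norm (g t) \<le> \<bar>B\<bar>"
      using B[of t] that A(2) by force
    then show ?thesis
      by (simp add: norm_mult mult.commute[of "norm (f t)"] mult_right_mono)
  qed
  ultimately show ?thesis
    by (intro set_integrable_bound[OF Cf]) auto
qed

text \<open>Isolates the factor that stays regular on the closed interval; the possible endpoint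
  singularities remain in the beta integrand.\<close>

lemma ext_2F1_integrand_minus_one:
  "ext_2F1_integrand \<Theta> \<alpha>\<^sub>1 \<alpha>\<^sub>2 1 (\<beta>\<^sub>1 - \<alpha>\<^sub>1) (-1) b d t =
     ext_beta_integrand \<Theta> b d \<alpha>\<^sub>2 (\<beta>\<^sub>1 - \<alpha>\<^sub>1 - \<alpha>\<^sub>2) t * of_real (1 + t) powr (- \<alpha>\<^sub>1)"
  by (simp add: ext_2F1_integrand_def ext_beta_integrand_def)

lemma ext_2F1_integrand_square:
  assumes "t \<in> {0<..<1}"
  shows "ext_2F1_integrand \<Theta> \<alpha>\<^sub>1 \<alpha>\<^sub>2 2 \<beta>\<^sub>1 1 b d t =
    ext_2F1_integrand \<Theta> \<alpha>\<^sub>1 \<alpha>\<^sub>2 1 (\<beta>\<^sub>1 - \<alpha>\<^sub>1) (-1) b d t"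
proof -
  have "(1 - 1 * of_real t ^ 2 :: complex) = of_real (1 - t) * of_real (1 + t)"
    by (simp add: algebra_simps power2_eq_square)
  \<comment> \<open>Principal powers are multiplicative here because both bases are positive
    reals.\<close>
  then have "(1 - 1 * of_real t ^ 2 :: complex) powr (- \<alpha>\<^sub>1) =
      of_real (1 - t) powr (- \<alpha>\<^sub>1) * of_real (1 + t) powr (- \<alpha>\<^sub>1)"
    using assms by (simp only:) (intro powr_times_real; simp)
  moreover have "(of_real (1 - t) :: complex) powr (\<beta>\<^sub>1 - \<alpha>\<^sub>1 - \<alpha>\<^sub>2 - 1) =
      of_real (1 - t) powr (\<beta>\<^sub>1 - \<alpha>\<^sub>2 - 1) * of_real (1 - t) powr (- \<alpha>\<^sub>1)"
    by (simp add: powr_add [symmetric] algebra_simps)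
  ultimately show ?thesis
    unfolding ext_2F1_integrand_minus_one
    by (simp only: ext_2F1_integrand_def ext_beta_integrand_def mult_ac)
qed

text \<open>Expanding \<open>Beta\<close> into \<open>Gamma\<close> values,
  \<open>Gamma (\<beta> - \<gamma>)\<close> and \<open>Gamma (\<beta> - a - \<gamma>)\<close> cancel
  on the right.\<close>

lemma Beta_quotient:
  fixes a \<beta> \<gamma> :: complex
  assumes "Re a > 0" and "Re (\<beta> - a - \<gamma>) > 0"
  shows "1 / Beta a (\<beta> - a) =
    Gamma \<beta> * Gamma (\<beta> - a - \<gamma>) / (Gamma (\<beta> - a) * Gamma (\<beta> - \<gamma>)) *
    (1 / Beta a (\<beta> - \<gamma> - a))"
proof -
  \<comment> \<open>\<open>Gamma\<close> takes the value 0 exactly at its poles, the non-positive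
    integers, by convention.\<close>
  have pos: "Gamma z \<noteq> 0" if "Re z > 0" for z :: complex
    using that by (auto simp: Gamma_eq_zero_iff elim!: nonpos_Ints_cases)
  \<comment> \<open>The real part of \<open>\<beta> - \<gamma>\<close> is the sum of the two assumed
    positive ones.\<close>
  have "Gamma a \<noteq> 0" "Gamma (\<beta> - a - \<gamma>) \<noteq> 0" "Gamma (\<beta> - \<gamma>) \<noteq> 0"
    using assms by (auto intro!: pos)
  moreover have "\<beta> - \<gamma> - a = \<beta> - a - \<gamma>"
    by simp
  ultimately show ?thesis
    by (simp add: Beta_def field_simps)
qed

theorem theorem2p8:
  fixes \<kappa> :: "nat \<Rightarrow> complex" and \<Theta> :: "complex \<Rightarrow> complex"
    and R M\<^sub>0 :: real and \<omega> \<alpha>\<^sub>1 \<alpha>\<^sub>2 \<beta>\<^sub>1 b d :: complex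
  assumes kernel: "theta_kernel \<kappa> R M\<^sub>0 \<omega> \<Theta>"
    and "Re \<beta>\<^sub>1 > Re \<alpha>\<^sub>2" and "Re \<alpha>\<^sub>2 > 0"
    and "Re (\<beta>\<^sub>1 - \<alpha>\<^sub>2 - \<alpha>\<^sub>1) > 0"
    and "min (Re b) (Re d) \<ge> 0"
    and conv_left: "\<And>n. ext_beta_converges \<Theta> b d (\<alpha>\<^sub>2 + of_nat (2 * n)) (\<beta>\<^sub>1 - \<alpha>\<^sub>2)"
    and conv_right: "\<And>n. ext_beta_converges \<Theta> b d (\<alpha>\<^sub>2 + of_nat n) (\<beta>\<^sub>1 - \<alpha>\<^sub>1 - \<alpha>\<^sub>2)"
  shows "ext_2F1_integral_converges \<Theta> \<alpha>\<^sub>1 \<alpha>\<^sub>2 2 \<beta>\<^sub>1 1 b d \<and>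
         ext_2F1_integral_converges \<Theta> \<alpha>\<^sub>1 \<alpha>\<^sub>2 1 (\<beta>\<^sub>1 - \<alpha>\<^sub>1) (-1) b d \<and>
         ext_2F1 \<Theta> \<alpha>\<^sub>1 \<alpha>\<^sub>2 2 \<beta>\<^sub>1 1 b d =
           Gamma \<beta>\<^sub>1 * Gamma (\<beta>\<^sub>1 - \<alpha>\<^sub>2 - \<alpha>\<^sub>1) / (Gamma (\<beta>\<^sub>1 - \<alpha>\<^sub>2) * Gamma (\<beta>\<^sub>1 - \<alpha>\<^sub>1)) *
           ext_2F1 \<Theta> \<alpha>\<^sub>1 \<alpha>\<^sub>2 1 (\<beta>\<^sub>1 - \<alpha>\<^sub>1) (-1) b d"
proof -
  let ?l = "ext_2F1_integrand \<Theta> \<alpha>\<^sub>1 \<alpha>\<^sub>2 2 \<beta>\<^sub>1 1 b d"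
  let ?r = "ext_2F1_integrand \<Theta> \<alpha>\<^sub>1 \<alpha>\<^sub>2 1 (\<beta>\<^sub>1 - \<alpha>\<^sub>1) (-1) b d"
  have "set_integrable lborel {0<..<1}
      (ext_beta_integrand \<Theta> b d \<alpha>\<^sub>2 (\<beta>\<^sub>1 - \<alpha>\<^sub>1 - \<alpha>\<^sub>2))"
    using conv_right[of 0] by (simp add: ext_beta_converges_def)
  \<comment> \<open>The base \<open>1 + t\<close> runs through [1, 2], away from 0 and the branch
    cut.\<close>
  moreover have "continuous_on {0..1} (\<lambda>t. of_real (1 + t) powr (- \<alpha>\<^sub>1) :: complex)"
    by (intro continuous_intros) (auto simp: complex_eq_iff)
  ultimately have r: "set_integrable lborel {0<..<1} ?r"
    unfolding ext_2F1_integrand_minus_one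
    by (rule set_integrable_mult_continuous_bounded[where K = "{0..1}"]) auto
  have "set_integrable lborel {0<..<1} ?l \<longleftrightarrow> set_integrable lborel {0<..<1} ?r"
    by (rule set_integrable_cong) (use ext_2F1_integrand_square in auto)
  moreover have "(LINT t:{0<..<1}|lborel. ?l t) = (LINT t:{0<..<1}|lborel. ?r t)"
    by (rule set_lebesgue_integral_cong) (use ext_2F1_integrand_square in auto)
  moreover have "1 / Beta \<alpha>\<^sub>2 (\<beta>\<^sub>1 - \<alpha>\<^sub>2) =
      Gamma \<beta>\<^sub>1 * Gamma (\<beta>\<^sub>1 - \<alpha>\<^sub>2 - \<alpha>\<^sub>1) / (Gamma (\<beta>\<^sub>1 - \<alpha>\<^sub>2) * Gamma (\<beta>\<^sub>1 - \<alpha>\<^sub>1)) *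
      (1 / Beta \<alpha>\<^sub>2 (\<beta>\<^sub>1 - \<alpha>\<^sub>1 - \<alpha>\<^sub>2))"
    using assms by (intro Beta_quotient)
  \<comment> \<open>Both arguments, 1 and -1, have norm 1, so \<open>ext_2F1\<close> unfolds to its
    integral branch on each side.\<close>
  ultimately show ?thesis
    using r by (simp add: ext_2F1_integral_converges_def ext_2F1_def mult.assoc)
qed

end
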